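(* Let $F$ be a finite simple graph and let $G$ be a $k$-fold cover of $F$. Then (a) if $F$ is $3$-regular, $\gamma(G) \geq \frac{3}{5}\,k\,\gamma(F)$; (b) if $F$ is $4$-regular or $5$-regular, $\gamma(G) \geq \frac{1}{2}\,k\,\gamma(F)$.
   Context: All graphs are finite, simple and undirected. A graph $G$ is a cover of a graph $F$ if there is an onto map $\pi: V(G)\to V(F)$ such that for every vertex $v$ of $G$, $\pi$ maps the neighbours of $v$ in $G$ bijectively onto the neighbours of $\pi(v)$ in $F$; the cover is $k$-fold if every fibre $\pi^{-1}(u)$ has exactly $k$ vertices. $\gamma(\cdot)$ denotes the domination number: the minimum size of a set $S$ of vertices such that every vertex not in $S$ has a neighbour in $S$. *)

theory Defs
  imports Complex_Main
begin

definition simple_graph :: "'a set \<Rightarrow> ('a \<Rightarrow> 'a \<Rightarrow> bool) \<Rightarrow> bool" where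
  "simple_graph V E \<longleftrightarrow> finite V \<and> (\<forall>u v. E u v \<longrightarrow> u \<in> V \<and> v \<in> V)
     \<and> (\<forall>u v. E u v \<longrightarrow> E v u) \<and> (\<forall>v. \<not> E v v)"

definition nbhd :: "'a set \<Rightarrow> ('a \<Rightarrow> 'a \<Rightarrow> bool) \<Rightarrow> 'a \<Rightarrow> 'a set" where
  "nbhd V E v = {u \<in> V. E v u}"

definition regular :: "'a set \<Rightarrow> ('a \<Rightarrow> 'a \<Rightarrow> bool) \<Rightarrow> nat \<Rightarrow> bool" where
  "regular V E d \<longleftrightarrow> (\<forall>v \<in> V. card (nbhd V E v) = d)"

definition dominating :: "'a set \<Rightarrow> ('a \<Rightarrow> 'a \<Rightarrow> bool) \<Rightarrow> 'a set \<Rightarrow> bool" where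
  "dominating V E S \<longleftrightarrow> S \<subseteq> V \<and> (\<forall>v \<in> V - S. \<exists>s \<in> S. E v s)"

definition domination_number :: "'a set \<Rightarrow> ('a \<Rightarrow> 'a \<Rightarrow> bool) \<Rightarrow> nat" where
  "domination_number V E = Min (card ` {S. dominating V E S})"

definition covering_map ::
  "'a set \<Rightarrow> ('a \<Rightarrow> 'a \<Rightarrow> bool) \<Rightarrow> 'b set \<Rightarrow> ('b \<Rightarrow> 'b \<Rightarrow> bool) \<Rightarrow> ('a \<Rightarrow> 'b) \<Rightarrow> bool" where
  "covering_map VG EG VF EF p \<longleftrightarrow> p ` VG = VF
     \<and> (\<forall>v \<in> VG. bij_betw p (nbhd VG EG v) (nbhd VF EF (p v)))"

definition k_fold_cover ::
  "'a set \<Rightarrow> ('a \<Rightarrow> 'a \<Rightarrow> bool) \<Rightarrow> 'b set \<Rightarrow> ('b \<Rightarrow> 'b \<Rightarrow> bool) \<Rightarrow> nat \<Rightarrow> bool" where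
  "k_fold_cover VG EG VF EF k \<longleftrightarrow> (\<exists>p. covering_map VG EG VF EF p
     \<and> (\<forall>u \<in> VF. card {v \<in> VG. p v = u} = k))"

end

theory Submission
  imports Defs
begin

text \<open>
  Closed neighbourhoods in a \<open>d\<close>-regular graph have \<open>d + 1\<close> elements, so a \<open>k\<close>-fold cover of \<open>F\<close> has
  domination number at least \<open>k n / (d + 1)\<close>, where \<open>n\<close> is the order of \<open>F\<close>. It remains to show that
  \<open>\<gamma>(F)\<close> is at most \<open>5 n / 12\<close>, \<open>2 n / 5\<close>, \<open>n / 3\<close> for \<open>d = 3, 4, 5\<close>.

  These bounds come from a weighted greedy algorithm. Let \<open>W\<close> be the set of vertices not yet
  dominated (white); the other vertices are blue. A white vertex has weight \<open>a\<close> and a blue vertex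
  with \<open>i\<close> white neighbours has weight \<open>b i\<close>. As long as \<open>W\<close> is nonempty, some set \<open>T\<close> of new dominators
  lowers the total weight by at least \<open>M\<close> times the size of \<open>T\<close>, whence \<open>M \<gamma>(F) \<le> a n\<close>. While some
  vertex dominates many white vertices, a single vertex suffices for \<open>T\<close>. Two situations need
  more: white components that are cycles, where \<open>T\<close> has up to three elements, and the final
  stage, in which every closed neighbourhood contains at most two white vertices. There, a maximum
  packing of closed neighbourhoods with two white vertices is used, as for minimum edge covers.
\<close>

section \<open>Closed neighbourhoods in regular graphs\<close>

locale regular_graph =
  fixes V :: "'v set" and E :: "'v \<Rightarrow> 'v \<Rightarrow> bool" and d :: nat
  assumes graph: "simple_graph V E" and reg: "regular V E d" and d_pos: "0 < d"
begin

abbreviation N :: "'v \<Rightarrow> 'v set" where "N \<equiv> nbhd V E"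

definition ball :: "'v \<Rightarrow> 'v set" where "ball x = insert x (N x)"

definition balls :: "'v set \<Rightarrow> 'v set" where "balls T = (\<Union>t\<in>T. ball t)"

abbreviation deg_in :: "'v set \<Rightarrow> 'v \<Rightarrow> nat" where "deg_in W x \<equiv> card (N x \<inter> W)"

lemma finite_V: "finite V" using graph by (simp add: simple_graph_def)

lemma N_iff: "y \<in> N x \<longleftrightarrow> E x y"
  using graph by (auto simp: simple_graph_def nbhd_def)

lemma N_sym: "y \<in> N x \<longleftrightarrow> x \<in> N y"
  using graph by (auto simp: N_iff simple_graph_def)

lemma N_irrefl [simp]: "x \<notin> N x"
  using graph by (auto simp: N_iff simple_graph_def)

lemma N_subset: "N x \<subseteq> V" by (auto simp: nbhd_def)

lemma finite_N [simp]: "finite (N x)" using N_subset finite_V finite_subset by blast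

lemma card_N: "x \<in> V \<Longrightarrow> card (N x) = d" using reg by (simp add: regular_def)

lemma in_V: "y \<in> N x \<Longrightarrow> x \<in> V \<and> y \<in> V"
  using N_sym N_subset by blast

lemma ball_sym: "y \<in> ball x \<longleftrightarrow> x \<in> ball y"
  using N_sym by (auto simp: ball_def)

lemma ball_subset: "x \<in> V \<Longrightarrow> ball x \<subseteq> V" using N_subset by (auto simp: ball_def)

lemma finite_ball [simp]: "finite (ball x)" by (simp add: ball_def)

lemma card_ball: "x \<in> V \<Longrightarrow> card (ball x) = Suc d" by (simp add: ball_def card_N)

lemma finite_balls: "finite T \<Longrightarrow> finite (balls T)" by (simp add: balls_def)

lemma dominating_iff: "dominating V E T \<longleftrightarrow> T \<subseteq> V \<and> V \<subseteq> balls T"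
proof -
  have "(\<exists>s\<in>T. E v s) \<longleftrightarrow> (\<exists>s\<in>T. v \<in> N s)" for v by (simp add: N_iff[symmetric] N_sym[of v])
  then show ?thesis
    unfolding dominating_def balls_def ball_def by auto
qed

lemma domination_number_le: "dominating V E T \<Longrightarrow> domination_number V E \<le> card T"
  unfolding domination_number_def
  using finite_V by (intro Min_le) (auto simp: dominating_def intro: finite_subset[of _ "card ` Pow V"])

text \<open>The closed neighbourhoods of a minimum dominating set cover \<open>V\<close>, and each
  has \<open>Suc d\<close> elements.\<close>

lemma card_le_domination_number: "card V \<le> Suc d * domination_number V E"
proof -
  have fin: "finite (card ` {S. dominating V E S})"
    using finite_V by (auto simp: dominating_def intro: finite_subset[of _ "card ` Pow V"])
  moreover have "dominating V E V" by (simp add: dominating_def)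
  ultimately have "domination_number V E \<in> card ` {S. dominating V E S}"
    unfolding domination_number_def by (intro Min_in) auto
  then obtain S where S: "dominating V E S" "domination_number V E = card S" by auto
  then have SV: "S \<subseteq> V" "V \<subseteq> balls S" by (auto simp: dominating_iff)
  then have finS: "finite S" using finite_V finite_subset by blast
  have "card V \<le> card (balls S)" using SV finS by (intro card_mono finite_balls)
  also have "\<dots> \<le> (\<Sum>s\<in>S. card (ball s))" unfolding balls_def by (rule card_UN_le[OF finS])
  also have "\<dots> = (\<Sum>s\<in>S. Suc d)" using SV by (intro sum.cong) (auto simp: card_ball)
  finally show ?thesis using S by (simp add: mult.commute)
qed

lemma double_count:
  assumes "A \<subseteq> V" "X \<subseteq> V"
  shows "(\<Sum>x\<in>X. card (N x \<inter> A)) = (\<Sum>u\<in>A. card (N u \<inter> X))"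
proof -
  have fin: "finite A" "finite X" using assms finite_V finite_subset by blast+
  have "(\<Sum>x\<in>X. card (N x \<inter> A)) = card (SIGMA x:X. N x \<inter> A)" using fin by simp
  also have "\<dots> = card (SIGMA u:A. N u \<inter> X)"
    by (rule bij_betw_same_card[of "\<lambda>(x,y). (y,x)"])
       (auto simp: bij_betw_def inj_on_def image_iff N_sym)
  finally show ?thesis using fin by simp
qed

text \<open>Membership in a closed neighbourhood is symmetric, so the summations can be swapped.
  Read as discharging: every \<open>x\<close> pays \<open>q x\<close> to each element of
  \<open>A\<close> in its closed neighbourhood.\<close>

lemma sum_card_ball:
  fixes q :: "'v \<Rightarrow> real"
  assumes "A \<subseteq> V"
  shows "(\<Sum>x\<in>V. real (card (ball x \<inter> A)) * q x) = (\<Sum>y\<in>A. \<Sum>x\<in>ball y. q x)"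
proof -
  have fin: "finite A" using assms finite_V finite_subset by blast
  have "(\<Sum>x\<in>V. real (card (ball x \<inter> A)) * q x) = (\<Sum>x\<in>V. \<Sum>y\<in>A. if y \<in> ball x then q x else 0)"
    using fin by (intro sum.cong refl) (simp add: sum.inter_restrict[symmetric] Int_commute)
  also have "\<dots> = (\<Sum>y\<in>A. \<Sum>x\<in>V. if y \<in> ball x then q x else 0)" by (rule sum.swap)
  also have "\<dots> = (\<Sum>y\<in>A. \<Sum>x\<in>ball y. q x)"
  proof (rule sum.cong[OF refl])
    fix y assume "y \<in> A"
    then have "ball y \<subseteq> V" using assms ball_subset by auto
    then have "(\<Sum>x\<in>V. if x \<in> ball y then q x else 0) = (\<Sum>x\<in>ball y. q x)"
      using finite_V by (simp add: sum.inter_restrict[symmetric] Int_absorb1)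
    then show "(\<Sum>x\<in>V. if y \<in> ball x then q x else 0) = (\<Sum>x\<in>ball y. q x)"
      by (simp only: ball_sym[of y])
  qed
  finally show ?thesis .
qed

end

section \<open>Weights, improving sets and single-vertex steps\<close>

locale potential = regular_graph +
  fixes a :: real and b :: "nat \<Rightarrow> real" and M :: real
  assumes b_0 [simp]: "b 0 = 0" and mono_b: "mono b" and b_le_a: "b i \<le> a"
begin

definition pot :: "'a set \<Rightarrow> real" where
  "pot W = (\<Sum>x\<in>V. if x \<in> W then a else b (deg_in W x))"

text \<open>The condition on \<open>W \<inter> balls T\<close> forces progress: the white set
  shrinks, so repeated improvement terminates.\<close>

definition improvable :: "'a set \<Rightarrow> bool" where
  "improvable W \<longleftrightarrow> (\<exists>T\<subseteq>V. W \<inter> balls T \<noteq> {} \<and> pot (W - balls T) + M * card T \<le> pot W)"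

text \<open>A lower bound \<open>\<delta>\<close> for the average weight that a blue vertex loses
  per lost white neighbour. It depends on \<open>W\<close>, so that a larger \<open>\<delta>\<close>
  becomes available once blue vertices with many white neighbours are excluded.\<close>

definition slope :: "'a set \<Rightarrow> real \<Rightarrow> bool" where
  "slope W \<delta> \<longleftrightarrow> 0 \<le> \<delta> \<and>
     (\<forall>x\<in>V - W. \<forall>j\<le>deg_in W x. b j + \<delta> * (real (deg_in W x) - real j) \<le> b (deg_in W x))"

text \<open>A newly dominated \<open>u\<close> drops from \<open>a\<close> to
  \<open>b (deg_in W' u)\<close>. Each of its \<open>d - deg_in W u\<close> edges to old blue
  vertices also accounts for a loss of at least \<open>\<delta>\<close> at the blue end; counting
  these edges from both sides allows crediting that loss to \<open>u\<close>. The second sum adds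
  what the blue vertices in \<open>X\<close> lose beyond this credit.\<close>

lemma pot_drop:
  assumes W: "W \<subseteq> V" and X: "X \<subseteq> V - W" and sl: "slope W \<delta>"
    and C: "C = W \<inter> Z" and W': "W' = W - Z"
  shows "(\<Sum>u\<in>C. a - b (deg_in W' u) + \<delta> * (real d - real (deg_in W u)))
       + (\<Sum>x\<in>X. b (deg_in W x) - b (deg_in W' x) - \<delta> * (real (deg_in W x) - real (deg_in W' x)))
       \<le> pot W - pot W'"
proof -
  have fin: "finite W" "finite X" "finite C" "finite (V - W)"
    using W X C finite_V finite_subset by blast+
  define f where "f x = b (deg_in W x) - b (deg_in W' x)" for x
  have le: "deg_in W' x \<le> deg_in W x" for x unfolding W' by (intro card_mono) auto
  have deg_diff: "real (deg_in W x) - real (deg_in W' x) = real (deg_in C x)" for x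
  proof -
    have "N x \<inter> W = (N x \<inter> W') \<union> (N x \<inter> C)" unfolding C W' by auto
    moreover have "(N x \<inter> W') \<inter> (N x \<inter> C) = {}" unfolding C W' by auto
    ultimately have "deg_in W x = deg_in W' x + deg_in C x" by (simp add: card_Un_disjoint)
    then show ?thesis by simp
  qed
  have ge: "\<delta> * real (deg_in C x) \<le> f x" if "x \<in> V - W" for x
  proof -
    have "b (deg_in W' x) + \<delta> * (real (deg_in W x) - real (deg_in W' x)) \<le> b (deg_in W x)"
      using sl that le[of x] unfolding slope_def by blast
    then show ?thesis unfolding f_def deg_diff by simp
  qed
  have "pot W - pot W' =
      (\<Sum>x\<in>V. (if x \<in> W then a else b (deg_in W x)) - (if x \<in> W' then a else b (deg_in W' x)))"
    by (simp add: pot_def sum_subtractf)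
  also have "\<dots> = (\<Sum>x\<in>C \<union> (V - W). (if x \<in> W then a else b (deg_in W x)) - (if x \<in> W' then a else b (deg_in W' x)))"
    using finite_V W unfolding C W' by (intro sum.mono_neutral_right) auto
  also have "\<dots> = (\<Sum>x\<in>C. (if x \<in> W then a else b (deg_in W x)) - (if x \<in> W' then a else b (deg_in W' x)))
     + (\<Sum>x\<in>V - W. (if x \<in> W then a else b (deg_in W x)) - (if x \<in> W' then a else b (deg_in W' x)))"
    using fin C by (intro sum.union_disjoint) auto
  also have "(\<Sum>x\<in>C. (if x \<in> W then a else b (deg_in W x)) - (if x \<in> W' then a else b (deg_in W' x)))
     = (\<Sum>u\<in>C. a - b (deg_in W' u))"
    using C W' by (intro sum.cong) auto
  also have "(\<Sum>x\<in>V - W. (if x \<in> W then a else b (deg_in W x)) - (if x \<in> W' then a else b (deg_in W' x)))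
     = (\<Sum>x\<in>V - W. f x)"
    using W' by (intro sum.cong) (auto simp: f_def)
  finally have eq: "pot W - pot W' = (\<Sum>u\<in>C. a - b (deg_in W' u)) + (\<Sum>x\<in>V - W. f x)" .
  have "(\<Sum>x\<in>X. f x - \<delta> * real (deg_in C x)) \<le> (\<Sum>x\<in>V - W. f x - \<delta> * real (deg_in C x))"
    using X fin ge by (intro sum_mono2) auto
  also have "\<dots> = (\<Sum>x\<in>V - W. f x) - \<delta> * real (\<Sum>x\<in>V - W. deg_in C x)"
    by (simp add: sum_subtractf sum_distrib_left)
  also have "(\<Sum>x\<in>V - W. deg_in C x) = (\<Sum>u\<in>C. deg_in (V - W) u)"
    using W C by (intro double_count) auto
  also have "\<delta> * real (\<Sum>u\<in>C. deg_in (V - W) u) = (\<Sum>u\<in>C. \<delta> * (real d - real (deg_in W u)))"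
  proof -
    have "real (deg_in (V - W) u) = real d - real (deg_in W u)" if "u \<in> C" for u
    proof -
      have "N u = (N u \<inter> (V - W)) \<union> (N u \<inter> W)" using N_subset by auto
      moreover have "(N u \<inter> (V - W)) \<inter> (N u \<inter> W) = {}" by auto
      ultimately have "card (N u) = deg_in (V - W) u + deg_in W u"
        by (metis card_Un_disjoint finite_Int finite_N)
      moreover have "card (N u) = d" using that C W by (intro card_N) auto
      ultimately show ?thesis by simp
    qed
    then show ?thesis by (simp add: sum_distrib_left)
  qed
  finally have "(\<Sum>x\<in>X. f x - \<delta> * real (deg_in C x)) \<le>
     (\<Sum>x\<in>V - W. f x) - (\<Sum>u\<in>C. \<delta> * (real d - real (deg_in W u)))" .
  then show ?thesis unfolding eq f_def[symmetric] deg_diff by (simp add: sum.distrib)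
qed

lemma deg_in_le_d: "u \<in> V \<Longrightarrow> deg_in W u \<le> d"
  using card_mono[of "N u" "N u \<inter> W"] card_N by auto

lemma improvableI:
  assumes W: "W \<subseteq> V" and T: "T \<subseteq> V" and A: "A \<subseteq> W \<inter> balls T" "A \<noteq> {}"
    and X: "X \<subseteq> V - W" "\<And>x. x \<in> X \<Longrightarrow> N x \<inter> W \<subseteq> balls T"
    and sl: "slope W \<delta>"
    and c: "\<And>u. u \<in> A \<Longrightarrow> c u \<le> a - b (deg_in (W - balls T) u) + \<delta> * (real d - real (deg_in W u))"
    and g: "\<And>x. x \<in> X \<Longrightarrow> g x \<le> b (deg_in W x) - \<delta> * real (deg_in W x)"
    and le: "M * card T \<le> (\<Sum>u\<in>A. c u) + (\<Sum>x\<in>X. g x)"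
  shows "improvable W"
proof -
  let ?W' = "W - balls T"
  let ?h = "\<lambda>u. a - b (deg_in ?W' u) + \<delta> * (real d - real (deg_in W u))"
  let ?k = "\<lambda>x. b (deg_in W x) - b (deg_in ?W' x) - \<delta> * (real (deg_in W x) - real (deg_in ?W' x))"
  have \<delta>: "0 \<le> \<delta>" using sl by (simp add: slope_def)
  have fin: "finite (W \<inter> balls T)" using W finite_V finite_subset by blast
  have "(\<Sum>u\<in>A. c u) \<le> (\<Sum>u\<in>A. ?h u)" using c by (intro sum_mono)
  also have "\<dots> \<le> (\<Sum>u\<in>W \<inter> balls T. ?h u)"
  proof (intro sum_mono2 fin A)
    fix u assume "u \<in> W \<inter> balls T - A"
    then have "u \<in> V" using W by auto
    then have "0 \<le> \<delta> * (real d - real (deg_in W u))" using \<delta> deg_in_le_d by simp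
    then show "0 \<le> ?h u" using b_le_a[of "deg_in ?W' u"] by simp
  qed
  finally have 1: "(\<Sum>u\<in>A. c u) \<le> (\<Sum>u\<in>W \<inter> balls T. ?h u)" .
  have "g x \<le> ?k x" if "x \<in> X" for x
  proof -
    have "N x \<inter> ?W' = {}" using X(2)[OF that] by auto
    then show ?thesis using g[OF that] by simp
  qed
  then have 2: "(\<Sum>x\<in>X. g x) \<le> (\<Sum>x\<in>X. ?k x)" by (intro sum_mono)
  have "pot ?W' + M * card T \<le> pot W"
    using pot_drop[OF W X(1) sl refl refl, of "balls T"] 1 2 le by linarith
  then show ?thesis unfolding improvable_def using T A by blast
qed

text \<open>Take \<open>v\<close>, of maximum white degree \<open>p\<close>, as the only dominator.
  It keeps no white neighbour, each of its \<open>p\<close> white neighbours keeps at most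
  \<open>p - 1\<close>, and all these vertices have at least \<open>d - p\<close> blue
  neighbours.\<close>

lemma white_step:
  assumes W: "W \<subseteq> V" and sl: "slope W \<delta>" and v: "v \<in> W" "deg_in W v = p"
    and max: "\<And>u. u \<in> W \<Longrightarrow> deg_in W u \<le> p"
    and M: "M \<le> (real p + 1) * (a + \<delta> * (real d - real p)) - real p * b (p - 1)"
  shows "improvable W"
proof (rule improvableI[where T = "{v}" and A = "insert v (N v \<inter> W)" and X = "{}" and \<delta> = \<delta>
      and c = "\<lambda>u. if u = v then a + \<delta> * (real d - real p) else a - b (p - 1) + \<delta> * (real d - real p)"
      and g = "\<lambda>_. 0"])
  have \<delta>: "0 \<le> \<delta>" using sl by (simp add: slope_def)
  fix u assume u: "u \<in> insert v (N v \<inter> W)"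
  show "(if u = v then a + \<delta> * (real d - real p) else a - b (p - 1) + \<delta> * (real d - real p))
      \<le> a - b (deg_in (W - balls {v}) u) + \<delta> * (real d - real (deg_in W u))"
  proof (cases "u = v")
    case True
    moreover have "N v \<inter> (W - balls {v}) = {}" by (auto simp: balls_def ball_def)
    ultimately show ?thesis using v by simp
  next
    case False
    then have u: "u \<in> N v" "u \<in> W" using u by auto
    have "N u \<inter> (W - balls {v}) \<subseteq> N u \<inter> W - {v}" by (auto simp: balls_def ball_def)
    then have "deg_in (W - balls {v}) u \<le> card (N u \<inter> W - {v})" by (intro card_mono) auto
    also have "\<dots> = deg_in W u - 1" using u v N_sym by auto
    also have "\<dots> \<le> p - 1" using max[OF u(2)] by simp
    finally have "b (deg_in (W - balls {v}) u) \<le> b (p - 1)" using mono_b by (rule monoD[rotated])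
    moreover have "\<delta> * (real d - real p) \<le> \<delta> * (real d - real (deg_in W u))"
      using \<delta> max[OF u(2)] by (intro mult_left_mono) auto
    ultimately show ?thesis using False by simp
  qed
next
  have "(\<Sum>u\<in>N v \<inter> W. if u = v then a + \<delta> * (real d - real p) else a - b (p - 1) + \<delta> * (real d - real p))
    = (\<Sum>u\<in>N v \<inter> W. a - b (p - 1) + \<delta> * (real d - real p))"
    by (intro sum.cong) auto
  then show "M * card {v} \<le> (\<Sum>u\<in>insert v (N v \<inter> W). if u = v then a + \<delta> * (real d - real p)
      else a - b (p - 1) + \<delta> * (real d - real p)) + (\<Sum>x\<in>{}. 0)"
    using M v by (simp add: algebra_simps)
qed (use W v sl in \<open>auto simp: balls_def ball_def\<close>)

text \<open>The dominator \<open>x\<close> turns its \<open>q\<close> white neighbours blue, each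
  with at most \<open>p\<close> white neighbours left. Its own weight \<open>b q\<close> vanishes
  too, but \<open>\<delta> * q\<close> of it is already credited to those neighbours.\<close>

lemma blue_step:
  assumes W: "W \<subseteq> V" and sl: "slope W \<delta>" and x: "x \<in> V - W" "deg_in W x = q" "0 < q"
    and max: "\<And>u. u \<in> W \<Longrightarrow> deg_in W u \<le> p"
    and M: "M \<le> real q * (a - b p + \<delta> * (real d - real p)) + b q - \<delta> * real q"
  shows "improvable W"
proof (rule improvableI[where T = "{x}" and A = "N x \<inter> W" and X = "{x}" and \<delta> = \<delta>
      and c = "\<lambda>u. a - b p + \<delta> * (real d - real p)" and g = "\<lambda>_. b q - \<delta> * real q"])
  have \<delta>: "0 \<le> \<delta>" using sl by (simp add: slope_def)
  fix u assume u: "u \<in> N x \<inter> W"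
  have "deg_in (W - balls {x}) u \<le> deg_in W u" by (intro card_mono) auto
  also have "\<dots> \<le> p" using max u by simp
  finally have "b (deg_in (W - balls {x}) u) \<le> b p" using mono_b by (rule monoD[rotated])
  moreover have "\<delta> * (real d - real p) \<le> \<delta> * (real d - real (deg_in W u))"
    using \<delta> max u by (intro mult_left_mono) auto
  ultimately show "a - b p + \<delta> * (real d - real p)
      \<le> a - b (deg_in (W - balls {x}) u) + \<delta> * (real d - real (deg_in W u))" by simp
next
  show "N x \<inter> W \<noteq> {}" using x by (metis card.empty less_irrefl)
qed (use W x sl M in \<open>auto simp: balls_def ball_def\<close>)

section \<open>Closed neighbourhoods with at most two white vertices\<close>

text \<open>The set \<open>T \<union> R\<close> completes the domination at once: \<open>T\<close>
  is a maximum packing of closed neighbourhoods with two white vertices, \<open>R\<close> the set of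
  white vertices it misses. The weight is distributed so that each vertex of \<open>R\<close>
  receives the bound in \<open>M_single\<close> and each pair at least the bound in
  \<open>M_pair\<close>.\<close>

lemma gain_two_step:
  assumes W: "W \<subseteq> V" "W \<noteq> {}" and white: "\<And>u. u \<in> W \<Longrightarrow> deg_in W u \<le> 1"
    and blue: "\<And>x. x \<in> V - W \<Longrightarrow> deg_in W x \<le> 2"
    and b21: "b 2 \<le> 2 * b 1"
    and M_single: "M \<le> a + real d * b 1"
    and M_pair: "M \<le> 2 * (a - b 2) + real d * (b 2 - b 1) + (real d + 2) * (b 2 / 2)"
  shows "improvable W"
proof -
  define S where "S x = ball x \<inter> W" for x
  have finW: "finite W" using W finite_V finite_subset by blast
  have fS [simp]: "finite (S x)" for x by (simp add: S_def)
  have S_iff: "y \<in> S x \<longleftrightarrow> y \<in> W \<and> x \<in> ball y" for x y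
    using ball_sym by (auto simp: S_def)
  have S_self: "y \<in> W \<Longrightarrow> y \<in> S y" for y by (auto simp: S_def ball_def)
  have S_W: "S x \<subseteq> W" for x by (auto simp: S_def)
  have S2: "card (S x) \<le> 2" if "x \<in> V" for x
  proof (cases "x \<in> W")
    case True
    then have "S x = insert x (N x \<inter> W)" by (auto simp: S_def ball_def)
    then show ?thesis using white[OF True] by simp
  next
    case False
    then have "S x = N x \<inter> W" by (auto simp: S_def ball_def)
    then show ?thesis using blue[of x] False that by simp
  qed
  have S_pair: "S x = {y, z}" if "x \<in> V" "y \<in> S x" "z \<in> S x" "y \<noteq> z" for x y z
  proof -
    have "card {y, z} = 2" using that by simp
    then show ?thesis using card_seteq[of "S x" "{y, z}"] S2[OF that(1)] that by simp
  qed
  have mate: "card (S r) = 2" if "y \<in> W" "r \<in> W" "r \<in> S y" "r \<noteq> y" for y r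
  proof -
    have "y \<in> S r" "r \<in> S r" using that S_iff ball_sym S_self by auto
    then have "S r = {y, r}" using S_pair[of r y r] that W by auto
    then show ?thesis using that by simp
  qed

  \<comment> \<open>By the last condition the packing covers both ends of every white edge, so that
    vertices outside it have no white neighbour.\<close>
  define good where "good T \<longleftrightarrow> T \<subseteq> V \<and> (\<forall>t\<in>T. card (S t) = 2)
    \<and> (\<forall>t\<in>T. \<forall>t'\<in>T. t \<noteq> t' \<longrightarrow> S t \<inter> S t' = {})
    \<and> (\<forall>y\<in>W. card (S y) = 2 \<longrightarrow> y \<in> \<Union>(S ` T))" for T
  obtain T0 where "good T0"
  proof -
    \<comment> \<open>Such packings exist: the white vertices induce isolated vertices and single
      edges, and a maximum family centred in \<open>W\<close> cannot miss an edge.\<close>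
    define pre where "pre T \<longleftrightarrow> T \<subseteq> W \<and> (\<forall>t\<in>T. card (S t) = 2)
      \<and> (\<forall>t\<in>T. \<forall>t'\<in>T. t \<noteq> t' \<longrightarrow> S t \<inter> S t' = {})" for T
    have "pre {}" by (simp add: pre_def)
    moreover have "\<forall>T. pre T \<longrightarrow> card T < Suc (card W)"
      using finW by (auto simp: pre_def less_Suc_eq_le intro: card_mono)
    ultimately have "\<exists>T. pre T \<and> (\<forall>T'. pre T' \<longrightarrow> card T' \<le> card T)"
      by (rule Lattices_Big.ex_has_greatest_nat)
    then obtain T where T: "pre T" and max: "\<And>T'. pre T' \<Longrightarrow> card T' \<le> card T" by blast
    have finT: "finite T" using T finW finite_subset by (auto simp: pre_def)
    have "y \<in> \<Union>(S ` T)" if y: "y \<in> W" "card (S y) = 2" for y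
    proof (rule ccontr)
      assume not: "y \<notin> \<Union>(S ` T)"
      have "S y \<inter> S t = {}" if t: "t \<in> T" for t
      proof (rule ccontr)
        assume "S y \<inter> S t \<noteq> {}"
        then obtain z where z: "z \<in> S y" "z \<in> S t" by auto
        have zy: "z \<noteq> y" using z not t by auto
        have tW: "t \<in> W" using t T by (auto simp: pre_def)
        have "y \<in> S z" "t \<in> S z" "z \<in> S z" using z y tW S_iff ball_sym S_self S_W by blast+
        then have "t = y \<or> t = z" using S_pair[of z y z] zy z(1) S_W W by blast
        then show False using not t \<open>y \<in> S z\<close> S_self[OF y(1)] by blast
      qed
      then have "pre (insert y T)" using T y unfolding pre_def by (auto simp: Int_commute)
      moreover have "y \<notin> T" using not S_self[OF y(1)] by auto
      ultimately show False using max[of "insert y T"] finT by simp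
    qed
    then have "good T" using T W unfolding pre_def good_def by auto
    then show ?thesis by (rule that)
  qed
  moreover have "\<forall>T. good T \<longrightarrow> card T < Suc (card V)"
    using finite_V by (auto simp: good_def less_Suc_eq_le intro: card_mono)
  ultimately have "\<exists>T. good T \<and> (\<forall>T'. good T' \<longrightarrow> card T' \<le> card T)"
    by (rule Lattices_Big.ex_has_greatest_nat)
  then obtain T where T: "good T" and max: "\<And>T'. good T' \<Longrightarrow> card T' \<le> card T" by blast
  have TV: "T \<subseteq> V" and T2: "\<And>t. t \<in> T \<Longrightarrow> card (S t) = 2"
    and disj: "\<And>t t'. t \<in> T \<Longrightarrow> t' \<in> T \<Longrightarrow> t \<noteq> t' \<Longrightarrow> S t \<inter> S t' = {}"
    and cov: "\<And>y. y \<in> W \<Longrightarrow> card (S y) = 2 \<Longrightarrow> y \<in> \<Union>(S ` T)"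
    using T unfolding good_def by auto
  have finT: "finite T" using TV finite_V finite_subset by auto
  define U where "U = \<Union>(S ` T)"
  define R where "R = W - U"
  have UW: "U \<subseteq> W" "R \<subseteq> W" "U \<inter> R = {}" "U \<union> R = W" using S_W by (auto simp: U_def R_def)
  have finUR: "finite U" "finite R" using UW finW finite_subset by auto
  have single: "card (S r) = 1" if "r \<in> R" for r
  proof -
    have r: "r \<in> W" "r \<in> V" using that UW W by auto
    then have "card (S r) \<noteq> 0" using S_self[OF r(1)] by auto
    moreover have "card (S r) \<noteq> 2" using cov r that by (auto simp: R_def U_def)
    ultimately show ?thesis using S2[OF r(2)] by linarith
  qed
  \<comment> \<open>A closed neighbourhood with two elements of \<open>R\<close> could be added to
    the packing.\<close>
  have noRR: "card (S x \<inter> R) \<le> 1" if x: "x \<in> V" for x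
  proof (rule ccontr)
    assume "\<not> card (S x \<inter> R) \<le> 1"
    moreover have "card (S x \<inter> R) \<le> card (S x)" by (intro card_mono) auto
    ultimately have c: "card (S x) = 2" "card (S x \<inter> R) = card (S x)" using S2[OF x] by linarith+
    then have "S x \<subseteq> R" using card_subset_eq[of "S x" "S x \<inter> R"] by auto
    then have "S x \<inter> U = {}" using UW by auto
    then have d: "S x \<inter> S t = {}" if "t \<in> T" for t using that by (auto simp: U_def)
    then have "x \<notin> T" using c by force
    moreover have "good (insert x T)" using T x c d unfolding good_def by (auto simp: Int_commute)
    ultimately show False using max[of "insert x T"] finT by simp
  qed
  \<comment> \<open>Otherwise replacing \<open>t\<close> by \<open>x1\<close> and \<open>x2\<close> enlarges the packing.\<close>
  have aug: "r1 = r2" if t: "t \<in> T" and ss: "S t = {s, s'}" "s \<noteq> s'" and x12: "x1 \<in> V" "x2 \<in> V"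
    and r12: "r1 \<in> R" "r2 \<in> R" and S12: "S x1 = {s, r1}" "S x2 = {s', r2}" for t s s' x1 x2 r1 r2
  proof (rule ccontr)
    assume ne: "r1 \<noteq> r2"
    let ?T = "insert x1 (insert x2 (T - {t}))"
    have sU: "s \<in> U" "s' \<in> U" using t ss by (auto simp: U_def)
    then have ne': "r1 \<noteq> s" "r1 \<noteq> s'" "r2 \<noteq> s" "r2 \<noteq> s'" using r12 UW by auto
    have d: "S x1 \<inter> S t' = {}" "S x2 \<inter> S t' = {}" if t': "t' \<in> T - {t}" for t'
    proof -
      have "S t \<inter> S t' = {}" using t' t by (intro disj) auto
      then have "s \<notin> S t'" "s' \<notin> S t'" using ss by auto
      moreover have "S t' \<subseteq> U" using t' by (auto simp: U_def)
      then have "r1 \<notin> S t'" "r2 \<notin> S t'" using r12 UW(3) by blast+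
      ultimately show "S x1 \<inter> S t' = {}" "S x2 \<inter> S t' = {}" using S12 by simp_all
    qed
    have d12: "S x1 \<inter> S x2 = {}" using S12 ne ne' ss by auto
    have c12: "card (S x1) = 2" "card (S x2) = 2" using S12 ne' by auto
    have n: "x1 \<notin> T - {t}" "x2 \<notin> T - {t}" "x1 \<noteq> x2" using d(1)[of x1] d(2)[of x2] d12 c12 by auto
    have "\<Union>(S ` T) \<subseteq> \<Union>(S ` ?T)"
    proof -
      have "\<Union>(S ` T) = S t \<union> \<Union>(S ` (T - {t}))" using t by auto
      then show ?thesis using ss S12 by auto
    qed
    then have 1: "\<forall>y\<in>W. card (S y) = 2 \<longrightarrow> y \<in> \<Union>(S ` ?T)" using cov by blast
    have 2: "\<forall>u\<in>?T. \<forall>u'\<in>?T. u \<noteq> u' \<longrightarrow> S u \<inter> S u' = {}"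
    proof (intro ballI impI)
      fix u u' assume u: "u \<in> ?T" "u' \<in> ?T" "u \<noteq> u'"
      have "S t' \<inter> S x1 = {}" "S t' \<inter> S x2 = {}" if "t' \<in> T - {t}" for t' using d[OF that] by auto
      moreover have "S x2 \<inter> S x1 = {}" using d12 by auto
      moreover have "u = x1 \<or> u = x2 \<or> u \<in> T - {t}" "u' = x1 \<or> u' = x2 \<or> u' \<in> T - {t}"
        using u by auto
      ultimately show "S u \<inter> S u' = {}" using u(3) d d12 disj[of u u'] by (elim disjE) simp_all
    qed
    have 3: "?T \<subseteq> V" "\<forall>u\<in>?T. card (S u) = 2" using x12 c12 TV T2 by auto
    have "good ?T" unfolding good_def by (intro conjI 1 2 3)
    moreover have "card ?T = Suc (Suc (card (T - {t})))" using n finT by simp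
    then have "card ?T = Suc (card T)" using card.remove[OF finT t] by simp
    ultimately show False using max[of ?T] by simp
  qed
  \<comment> \<open>The closed neighbourhoods shared between the pair \<open>S t\<close> and an
    element of \<open>R\<close>; only these may pay the pair less than \<open>b 2 / 2\<close> per
    element.\<close>
  define Q where "Q t = {x \<in> V. S x \<inter> R \<noteq> {} \<and> S x \<inter> S t \<noteq> {}}" for t
  have Q_pair: "\<exists>s r. s \<in> S t \<and> r \<in> R \<and> s \<noteq> r \<and> S x = {s, r}" if tx: "t \<in> T" "x \<in> Q t" for t x
  proof -
    obtain s r where sr: "s \<in> S x" "s \<in> S t" "r \<in> S x" "r \<in> R" "x \<in> V" using tx by (auto simp: Q_def)
    moreover have "s \<noteq> r" using sr tx UW by (auto simp: U_def)
    ultimately show ?thesis using S_pair[of x s r] by blast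
  qed
  \<comment> \<open>If \<open>x\<close> were white, \<open>r\<close> would be an end of a white
    edge.\<close>
  have Q_blue: "x \<notin> W" if t: "t \<in> T" "x \<in> Q t" for t x
  proof
    assume xW: "x \<in> W"
    obtain s r where sr: "s \<in> S t" "r \<in> R" "s \<noteq> r" "S x = {s, r}" using Q_pair[OF t] by blast
    then have "card (S x) = 2" by simp
    then have "r \<noteq> x" using single sr by force
    then have "card (S r) = 2" using mate[of x r] sr xW UW by auto
    then show False using single sr by simp
  qed
  \<comment> \<open>Either the closed neighbourhoods of all members of \<open>Q t\<close> share an
    element of \<open>S t\<close>, or \<open>aug\<close> forces them to share an element of
    \<open>R\<close>. In both cases the members are blue neighbours of a single white
    vertex.\<close>
  have Q_card: "card (Q t) \<le> d" if t: "t \<in> T" for t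
  proof -
    obtain s s' where ss: "S t = {s, s'}" "s \<noteq> s'" using T2[OF t] by (auto simp: card_2_iff)
    have sW: "s \<in> W" "s' \<in> W" using ss S_W by auto
    have sub: "card (Q t) \<le> d" if "y \<in> W" "\<And>x. x \<in> Q t \<Longrightarrow> y \<in> S x" for y
    proof -
      have "Q t \<subseteq> N y"
      proof
        fix x assume x: "x \<in> Q t"
        then have "x \<in> ball y" "x \<notin> W" using that S_iff Q_blue[OF t] by auto
        then show "x \<in> N y" using that(1) by (auto simp: ball_def)
      qed
      then have "card (Q t) \<le> card (N y)" by (intro card_mono) auto
      then show ?thesis using card_N that W by auto
    qed
    have cases: "s \<in> S x \<or> s' \<in> S x" if "x \<in> Q t" for x using that ss by (auto simp: Q_def)
    show ?thesis
    proof (cases "\<exists>x1\<in>Q t. \<exists>x2\<in>Q t. s \<in> S x1 \<and> s' \<in> S x2")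
      case False
      then have "(\<forall>x\<in>Q t. s \<in> S x) \<or> (\<forall>x\<in>Q t. s' \<in> S x)" using cases by blast
      then show ?thesis using sub sW by blast
    next
      case True
      then obtain x1 x2 where x12: "x1 \<in> Q t" "x2 \<in> Q t" "s \<in> S x1" "s' \<in> S x2" by blast
      have sU: "s \<notin> R" "s' \<notin> R" using t ss by (auto simp: U_def R_def)
      have ex: "\<exists>r\<in>R. S x = {y, r}" if "x \<in> Q t" "y \<in> S x" "y \<in> {s, s'}" for x y
        using Q_pair[OF t that(1)] that sU by auto
      obtain r1 where r1: "r1 \<in> R" "S x1 = {s, r1}" using ex x12 by blast
      obtain r2 where r2: "r2 \<in> R" "S x2 = {s', r2}" using ex x12 by blast
      have QV: "x \<in> V" if "x \<in> Q t" for x using that by (simp add: Q_def)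
      have "r1 \<in> S x" if x: "x \<in> Q t" for x
        using cases[OF x]
      proof
        assume "s \<in> S x"
        then obtain r where r: "r \<in> R" "S x = {s, r}" using ex x by blast
        then show ?thesis using aug[OF t ss QV[OF x] QV[OF x12(2)] _ r2(1) _ r2(2)]
          aug[OF t ss QV[OF x12(1)] QV[OF x12(2)] r1(1) r2(1) r1(2) r2(2)] by blast
      next
        assume "s' \<in> S x"
        then obtain r where r: "r \<in> R" "S x = {s', r}" using ex x by blast
        then show ?thesis using aug[OF t ss QV[OF x12(1)] QV[OF x] r1(1) _ r1(2)] by blast
      qed
      then show ?thesis using sub r1 UW by blast
    qed
  qed

  \<comment> \<open>Every closed neighbourhood pays \<open>b 1\<close> to its element of \<open>R\<close>; what remains is shared by its elements of \<open>U\<close>.\<close>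
  define q where "q x = (if S x \<inter> R \<noteq> {} then b 2 - b 1 else b 2 / 2)" for x
  have pay: "b 1 * real (card (ball x \<inter> R)) + real (card (ball x \<inter> U)) * q x \<le> b (card (S x))"
    if x: "x \<in> V" for x
  proof -
    have eq: "ball x \<inter> R = S x \<inter> R" "ball x \<inter> U = S x \<inter> U" using UW by (auto simp: S_def)
    have "S x = (S x \<inter> R) \<union> (S x \<inter> U)" using UW S_W[of x] by auto
    moreover have "(S x \<inter> R) \<inter> (S x \<inter> U) = {}" using UW by auto
    ultimately have sum: "card (S x) = card (S x \<inter> R) + card (S x \<inter> U)"
      by (metis card_Un_disjoint fS finite_Int)
    consider "card (S x \<inter> R) = 0" | "card (S x \<inter> R) = 1" using noRR[OF x] by linarith
    then show ?thesis
    proof cases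
      case 1
      then have "q x = b 2 / 2" by (simp add: q_def)
      moreover have "card (S x \<inter> U) = 0 \<or> card (S x \<inter> U) = 1 \<or> card (S x \<inter> U) = 2"
        using S2[OF x] sum by linarith
      ultimately show ?thesis using 1 sum b21 unfolding eq by (auto simp del: card_0_eq)
    next
      case 2
      then have "q x = b 2 - b 1" by (auto simp: q_def)
      moreover have "card (S x \<inter> U) = 0 \<or> card (S x \<inter> U) = 1"
        using S2[OF x] sum 2 by linarith
      ultimately show ?thesis using 2 sum unfolding eq by (auto simp: numeral_2_eq_2 simp del: card_0_eq)
    qed
  qed
  \<comment> \<open>There are \<open>2 * (d + 1)\<close> incidences between closed neighbourhoods
    and elements of \<open>S t\<close>. At most \<open>d\<close> of them come from
    \<open>Q t\<close>, whose members meet \<open>S t\<close> only once; the others pay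
    \<open>b 2 / 2\<close> each.\<close>
  have pair: "real d * (b 2 - b 1) + (real d + 2) * (b 2 / 2) \<le> (\<Sum>y\<in>S t. \<Sum>x\<in>ball y. q x)"
    if t: "t \<in> T" for t
  proof -
    have StV: "S t \<subseteq> V" using S_W W by auto
    have "(\<Sum>x\<in>V. real (card (ball x \<inter> S t))) = (\<Sum>y\<in>S t. \<Sum>x\<in>ball y. 1)"
      using sum_card_ball[OF StV, of "\<lambda>_. 1"] by simp
    also have "\<dots> = (\<Sum>y\<in>S t. real d + 1)" using StV by (intro sum.cong refl) (auto simp: card_ball)
    also have "\<dots> = 2 * (real d + 1)" using T2[OF t] by simp
    finally have tot: "(\<Sum>x\<in>V. real (card (ball x \<inter> S t))) = 2 * (real d + 1)" .
    have "(\<Sum>x\<in>Q t. real (card (ball x \<inter> S t))) \<le> (\<Sum>x\<in>Q t. 1)"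
    proof (intro sum_mono)
      fix x assume x: "x \<in> Q t"
      obtain s r where sr: "s \<in> S t" "r \<in> R" "s \<noteq> r" "S x = {s, r}" using Q_pair[OF t x] by blast
      have "ball x \<inter> S t \<subseteq> {s}"
      proof -
        have "ball x \<inter> S t \<subseteq> S x" using S_W by (auto simp: S_def)
        moreover have "r \<notin> S t" using sr t by (auto simp: R_def U_def)
        ultimately show ?thesis using sr by auto
      qed
      then have "card (ball x \<inter> S t) \<le> card {s}" by (intro card_mono) auto
      then show "real (card (ball x \<inter> S t)) \<le> 1" by simp
    qed
    also have "\<dots> \<le> real d" using Q_card[OF t] by simp
    finally have bad: "(\<Sum>x\<in>Q t. real (card (ball x \<inter> S t))) \<le> real d" .
    have "(\<Sum>y\<in>S t. \<Sum>x\<in>ball y. q x) = (\<Sum>x\<in>V. real (card (ball x \<inter> S t)) * q x)"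
      by (rule sum_card_ball[OF StV, symmetric])
    also have "\<dots> = (\<Sum>x\<in>V. b 2 / 2 * real (card (ball x \<inter> S t))
        - (if x \<in> Q t then (b 1 - b 2 / 2) * real (card (ball x \<inter> S t)) else 0))"
    proof (intro sum.cong refl)
      fix x assume x: "x \<in> V"
      have "ball x \<inter> S t = S x \<inter> S t" using S_W by (auto simp: S_def)
      then show "real (card (ball x \<inter> S t)) * q x = b 2 / 2 * real (card (ball x \<inter> S t))
        - (if x \<in> Q t then (b 1 - b 2 / 2) * real (card (ball x \<inter> S t)) else 0)"
        using x by (auto simp: q_def Q_def algebra_simps)
    qed
    also have "\<dots> = b 2 / 2 * (\<Sum>x\<in>V. real (card (ball x \<inter> S t)))
        - (b 1 - b 2 / 2) * (\<Sum>x\<in>Q t. real (card (ball x \<inter> S t)))"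
    proof -
      have "Q t \<subseteq> V" by (auto simp: Q_def)
      then have "V \<inter> Q t = Q t" by auto
      then show ?thesis
        using finite_V by (simp add: sum_subtractf sum_distrib_left sum.inter_restrict[symmetric])
    qed
    finally have eq: "(\<Sum>y\<in>S t. \<Sum>x\<in>ball y. q x) =
      b 2 / 2 * (2 * (real d + 1)) - (b 1 - b 2 / 2) * (\<Sum>x\<in>Q t. real (card (ball x \<inter> S t)))"
      unfolding tot .
    have "(b 1 - b 2 / 2) * (\<Sum>x\<in>Q t. real (card (ball x \<inter> S t))) \<le> (b 1 - b 2 / 2) * real d"
      using bad b21 by (intro mult_left_mono) auto
    then show ?thesis unfolding eq by (simp add: field_simps)
  qed

  have sum_U: "(\<Sum>y\<in>U. h y) = (\<Sum>t\<in>T. \<Sum>y\<in>S t. h y)" for h :: "'a \<Rightarrow> real"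
    unfolding U_def using finT disj by (intro sum.UNION_disjoint) auto
  \<comment> \<open>Every vertex is charged according to its closed neighbourhood, which for a white
    vertex contains the vertex itself; a white \<open>y\<close> keeps the difference to
    \<open>a\<close>.\<close>
  have "pot W = (\<Sum>x\<in>V. b (card (S x)) + (if x \<in> W then a - b (card (S x)) else 0))"
    unfolding pot_def
  proof (intro sum.cong refl)
    fix x
    have "x \<notin> W \<Longrightarrow> S x = N x \<inter> W" by (auto simp: S_def ball_def)
    then show "(if x \<in> W then a else b (deg_in W x)) =
      b (card (S x)) + (if x \<in> W then a - b (card (S x)) else 0)" by auto
  qed
  also have "\<dots> = (\<Sum>x\<in>V. b (card (S x))) + (\<Sum>y\<in>W. a - b (card (S y)))"
    using finite_V W by (simp add: sum.distrib sum.inter_restrict[symmetric] Int_absorb1)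
  also have "(\<Sum>y\<in>W. a - b (card (S y))) = (\<Sum>y\<in>R. a - b (card (S y))) + (\<Sum>y\<in>U. a - b (card (S y)))"
    using UW finUR by (metis sum.union_disjoint Int_commute Un_commute)
  finally have pot: "pot W = (\<Sum>x\<in>V. b (card (S x))) + (\<Sum>y\<in>R. a - b (card (S y)))
      + (\<Sum>y\<in>U. a - b (card (S y)))" by simp
  have "real (card R) * ((real d + 1) * b 1) + (\<Sum>y\<in>U. \<Sum>x\<in>ball y. q x) \<le> (\<Sum>x\<in>V. b (card (S x)))"
  proof -
    have "(\<Sum>y\<in>R. \<Sum>x\<in>ball y. b 1) = real (card R) * ((real d + 1) * b 1)"
    proof -
      have "(\<Sum>y\<in>R. \<Sum>x\<in>ball y. b 1) = (\<Sum>y\<in>R. (real d + 1) * b 1)"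
        using UW W by (intro sum.cong refl) (auto simp: card_ball subset_iff)
      then show ?thesis by simp
    qed
    then have "real (card R) * ((real d + 1) * b 1) + (\<Sum>y\<in>U. \<Sum>x\<in>ball y. q x)
      = (\<Sum>x\<in>V. real (card (ball x \<inter> R)) * b 1 + real (card (ball x \<inter> U)) * q x)"
      using sum_card_ball[of R "\<lambda>_. b 1"] sum_card_ball[of U q] UW W by (simp add: sum.distrib)
    also have "\<dots> \<le> (\<Sum>x\<in>V. b (card (S x)))"
      using pay by (intro sum_mono) (simp add: mult.commute)
    finally show ?thesis .
  qed
  moreover have "(\<Sum>y\<in>R. a - b (card (S y))) = real (card R) * (a - b 1)"
    using single by simp
  moreover have "(\<Sum>t\<in>T. 2 * (a - b 2)) \<le> (\<Sum>y\<in>U. a - b (card (S y)))"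
    unfolding sum_U
  proof (intro sum_mono)
    fix t assume t: "t \<in> T"
    have "(\<Sum>y\<in>S t. a - b 2) \<le> (\<Sum>y\<in>S t. a - b (card (S y)))"
    proof (intro sum_mono)
      fix y assume "y \<in> S t"
      then have "card (S y) \<le> 2" using S2 S_W W by blast
      then have "b (card (S y)) \<le> b 2" using mono_b by (rule monoD[rotated])
      then show "a - b 2 \<le> a - b (card (S y))" by simp
    qed
    then show "2 * (a - b 2) \<le> (\<Sum>y\<in>S t. a - b (card (S y)))" using T2[OF t] by simp
  qed
  moreover have "(\<Sum>t\<in>T. real d * (b 2 - b 1) + (real d + 2) * (b 2 / 2)) \<le> (\<Sum>y\<in>U. \<Sum>x\<in>ball y. q x)"
    unfolding sum_U using pair by (intro sum_mono)
  moreover have "real (card R) * M \<le> real (card R) * (a + real d * b 1)"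
    using M_single by (intro mult_left_mono) auto
  moreover have "real (card T) * M \<le>
      real (card T) * (2 * (a - b 2) + real d * (b 2 - b 1) + (real d + 2) * (b 2 / 2))"
    using M_pair by (intro mult_left_mono) auto
  ultimately have bound: "M * (real (card T) + real (card R)) \<le> pot W"
    unfolding pot by (simp add: algebra_simps)

  have "W \<subseteq> balls (T \<union> R)"
  proof
    fix y assume "y \<in> W"
    then consider "y \<in> R" | t where "t \<in> T" "y \<in> S t" using UW by (auto simp: U_def)
    then show "y \<in> balls (T \<union> R)"
      by cases (auto simp: balls_def ball_def S_def)
  qed
  then have empty: "W - balls (T \<union> R) = {}" and "W \<inter> balls (T \<union> R) = W" by auto
  moreover have "pot (W - balls (T \<union> R)) = 0" unfolding empty by (simp add: pot_def)
  moreover have "T \<inter> R = {}"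
  proof -
    have "False" if "t \<in> T" "t \<in> R" for t using T2[OF that(1)] single[OF that(2)] by simp
    then show ?thesis by auto
  qed
  then have "card (T \<union> R) = card T + card R" using finT finUR by (simp add: card_Un_disjoint)
  moreover have "T \<union> R \<subseteq> V" using TV UW W by auto
  ultimately show ?thesis unfolding improvable_def using bound W by (intro exI[of _ "T \<union> R"]) simp
qed

section \<open>Cycles of white vertices\<close>

text \<open>Without an improvement, a white vertex of degree 2 lies on a white cycle of length 4,
  since path ends, triangles and longer cycles admit improving sets. A blue vertex \<open>x\<close>
  next to the 4-cycle then gives a contradiction. \<open>e\<close> is the least gain from a white
  vertex all of whose white neighbours are dominated too. The bounds on \<open>M\<close> weigh 3, 5,
  6, 6 and 8 white vertices against 1, 2, 2, 2 and 3 dominators.\<close>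

lemma cycle_step:
  fixes \<delta> :: real
  defines "e \<equiv> a + \<delta> * (real d - 2)"
  assumes W: "W \<subseteq> V" and sl: "slope W \<delta>" and d3: "3 \<le> d"
    and white: "\<And>u. u \<in> W \<Longrightarrow> deg_in W u \<le> 2" and blue: "\<And>x. x \<in> V - W \<Longrightarrow> deg_in W x \<le> 3"
    and v0: "v0 \<in> W" "deg_in W v0 = 2"
    and M: "M \<le> 3 * e - b 1 - \<delta>" "2 * M \<le> 5 * e" "2 * M \<le> 6 * e - 2 * b 1"
      "2 * M \<le> 6 * e - 2 * b 2 + b 1 - \<delta>" "3 * M \<le> 8 * e + b 1 - \<delta>"
  shows "improvable W"
proof (rule ccontr)
  assume no: "\<not> improvable W"
  have \<delta>: "0 \<le> \<delta>" using sl by (simp add: slope_def)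
  have b_01: "0 \<le> b 1" "b 1 \<le> b 2" using mono_b[THEN monoD, of 0 1] mono_b[THEN monoD, of 1 2] by auto
  have WV: "u \<in> V" if "u \<in> W" for u using that W by auto
  \<comment> \<open>The gain credited to a newly dominated \<open>u\<close>. The bounds that follow
    depend on how many white neighbours \<open>u\<close> may keep: none, one or two.\<close>
  define val where "val T u = a - b (deg_in (W - balls T) u) + \<delta> * (real d - real (deg_in W u))" for T u
  have val_deg: "e - b i + \<delta> * (2 - real j) \<le> val T u"
    if "u \<in> W" "deg_in (W - balls T) u \<le> i" "deg_in W u \<le> j" for T u i j
  proof -
    have "b (deg_in (W - balls T) u) \<le> b i" using that(2) by (intro monoD[OF mono_b])
    moreover have "\<delta> * (real d - real j) \<le> \<delta> * (real d - real (deg_in W u))"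
      using that \<delta> by (intro mult_left_mono) auto
    ultimately show ?thesis unfolding val_def e_def by (simp add: algebra_simps)
  qed
  have val0: "e \<le> val T u" if "u \<in> W" "N u \<inter> W = S" "S \<subseteq> balls T" for T u S
  proof -
    have "N u \<inter> (W - balls T) = {}" using that by auto
    then show ?thesis using val_deg[of u T 0 2] that(1) white[OF that(1)] by simp
  qed
  have val1: "e - b 1 \<le> val T u" if u: "u \<in> W" and z: "z \<in> N u \<inter> W" "z \<in> balls T" for T u z
  proof -
    have "deg_in (W - balls T) u \<le> card (N u \<inter> W - {z})" using z by (intro card_mono) auto
    also have "\<dots> = deg_in W u - 1" using z by simp
    also have "\<dots> \<le> 1" using white[OF u] by simp
    finally show ?thesis using val_deg[of u T 1 2] u white by simp
  qed
  have deg_mono: "deg_in (W - Z) u \<le> deg_in W u" for Z u by (intro card_mono) auto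
  have val2: "e - b 2 \<le> val T u" if "u \<in> W" for T u
    using val_deg[of u T 2 2] that white deg_mono[of u "balls T"] by fastforce
  have val_low: "e - b 1 + \<delta> \<le> val T u" if "u \<in> W" "deg_in W u \<le> 1" for T u
    using val_deg[of u T 1 1] that deg_mono[of u "balls T"] by fastforce
  \<comment> \<open>A vertex of \<open>X\<close> yields at least \<open>b 1 - \<delta>\<close>: by
    the slope condition, each white neighbour beyond the first adds at least \<open>\<delta>\<close>
    to its weight, which pays for the credit.\<close>
  have step: False
    if "T \<subseteq> V" "A \<subseteq> W \<inter> balls T" "A \<noteq> {}" "X \<subseteq> V - W" "\<And>x. x \<in> X \<Longrightarrow> N x \<inter> W \<subseteq> balls T"
      "\<And>x. x \<in> X \<Longrightarrow> N x \<inter> W \<noteq> {}"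
      "M * card T \<le> (\<Sum>u\<in>A. val T u) + (\<Sum>x\<in>X. b 1 - \<delta>)" for T A X
  proof -
    have "b 1 - \<delta> \<le> b (deg_in W x) - \<delta> * real (deg_in W x)" if x: "x \<in> X" for x
    proof -
      have "1 \<le> deg_in W x" using \<open>\<And>x. x \<in> X \<Longrightarrow> N x \<inter> W \<noteq> {}\<close>[OF x] by (simp add: Suc_le_eq card_gt_0_iff)
      then have "b 1 + \<delta> * (real (deg_in W x) - real 1) \<le> b (deg_in W x)"
        using sl x \<open>X \<subseteq> V - W\<close> unfolding slope_def by blast
      then show ?thesis by (simp add: algebra_simps)
    qed
    then have "improvable W"
      using that by (intro improvableI[OF W, of T A X \<delta> "val T" "\<lambda>_. b 1 - \<delta>"] sl) (auto simp: val_def)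
    then show False using no by simp
  qed
  have self: "t \<in> balls T" if "t \<in> T" for t T using that by (auto simp: balls_def ball_def)
  have nb: "u \<in> balls T" if "t \<in> T" "u \<in> N t" for t u T using that by (auto simp: balls_def ball_def)
  have nbW: "u \<in> N v" "u \<in> W" "v \<in> N u" if "N v \<inter> W = S" "u \<in> S" for u v S
    using that N_sym by auto

  have card2: "\<exists>w. w \<noteq> u \<and> S = {u, w}" if "card S = 2" "u \<in> S" for S :: "'a set" and u
    using that by (metis card_2_iff doubleton_eq_iff insertE singletonD)
  have pairI: "S = {p, r}" if "card S = 2" "p \<in> S" "r \<in> S" "p \<noteq> r" for S :: "'a set" and p r
    using that card2 by blast
  \<comment> \<open>If \<open>u\<close> ended a path, \<open>v\<close> alone would dominate
    \<open>u\<close>, \<open>v\<close>, \<open>w\<close>, with only \<open>w\<close> possibly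
    keeping a white neighbour: a gain of \<open>3 * e - b 1\<close>.\<close>
  have deg2: "deg_in W u = 2" if v: "v \<in> W" "deg_in W v = 2" and u: "u \<in> N v \<inter> W" for u v
  proof (rule ccontr)
    assume "deg_in W u \<noteq> 2"
    then have "deg_in W u \<le> 1" using white[of u] u by fastforce
    moreover have vu: "v \<in> N u \<inter> W" using u v N_sym by auto
    ultimately have Nu: "N u \<inter> W = {v}" using card_le_Suc0_iff_eq[of "N u \<inter> W"] by auto
    obtain w where w: "N v \<inter> W = {u, w}" "u \<noteq> w" using card2[OF v(2) u] by blast
    show False
    proof (rule step[of "{v}" "{v, u, w}" "{}"])
      have "e \<le> val {v} v" using nbW[OF w(1)] by (intro val0[OF v(1) w(1)]) (auto simp: nb)
      moreover have "e \<le> val {v} u" using u by (intro val0[OF _ Nu]) (auto simp: self)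
      moreover have "e - b 1 \<le> val {v} w"
        using nbW[OF w(1), of w] v by (intro val1[of _ v]) (auto simp: self)
      moreover have "v \<noteq> u" "v \<noteq> w" using nbW[OF w(1), of u] nbW[OF w(1), of w] by auto
      ultimately show "M * card {v} \<le> (\<Sum>u\<in>{v, u, w}. val {v} u) + (\<Sum>x\<in>{}. b 1 - \<delta>)"
        using w M \<delta> by simp
    qed (use v W nbW[OF w(1)] in \<open>auto simp: balls_def ball_def\<close>)
  qed
  \<comment> \<open>One vertex dominates a whole triangle, with gain \<open>3 * e\<close>.\<close>
  have tri: "u2 \<notin> N u1" if v: "v \<in> W" and u: "N v \<inter> W = {u1, u2}" "u1 \<noteq> u2" for v u1 u2
  proof
    assume tr: "u2 \<in> N u1"
    have uW: "u1 \<in> W" "u2 \<in> W" "v \<in> N u1" "v \<in> N u2" "u1 \<in> N v" "u2 \<in> N v" using nbW[OF u(1)] by auto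
    have dv: "deg_in W v = 2" using u by simp
    have 1: "N u1 \<inter> W = {v, u2}"
      using deg2[OF v dv, of u1] uW v tr by (intro pairI) auto
    have 2: "N u2 \<inter> W = {v, u1}"
      using deg2[OF v dv, of u2] uW v tr N_sym[of u2] by (intro pairI) auto
    show False
    proof (rule step[of "{v}" "{v, u1, u2}" "{}"])
      have "{v, u1, u2} \<subseteq> balls {v}" using uW by (auto simp: self nb)
      then have "e \<le> val {v} v" "e \<le> val {v} u1" "e \<le> val {v} u2"
        using val0[OF v u(1)] val0[OF uW(1) 1] val0[OF uW(2) 2] by simp_all
      moreover have "v \<noteq> u1" "v \<noteq> u2" using uW by auto
      ultimately show "M * card {v} \<le> (\<Sum>u\<in>{v, u1, u2}. val {v} u) + (\<Sum>x\<in>{}. b 1 - \<delta>)"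
        using u M \<delta> b_01 by simp
    qed (use v W uW in \<open>auto simp: balls_def ball_def\<close>)
  qed
  have other_nb: "\<exists>z. z \<noteq> v \<and> N u \<inter> W = {v, z} \<and> z \<in> W \<and> deg_in W z = 2"
    if v: "v \<in> W" "deg_in W v = 2" and u: "u \<in> N v" "u \<in> W" for v u
  proof -
    have du: "deg_in W u = 2" using deg2[OF v, of u] u by simp
    have "v \<in> N u \<inter> W" using v u N_sym by auto
    then obtain z where z: "N u \<inter> W = {v, z}" "z \<noteq> v" using card2[OF du] by blast
    then have "z \<in> N u \<inter> W" by auto
    then show ?thesis using z deg2[OF u(2) du, of z] by auto
  qed
  \<comment> \<open>Longer cycles admit \<open>T = {v, z1}\<close> (length 5) or \<open>T = {v, y}\<close> (length at least 6).\<close>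
  have c4: "\<exists>u1 u2 z. u1 \<noteq> u2 \<and> z \<noteq> v \<and> N v \<inter> W = {u1, u2} \<and> N u1 \<inter> W = {v, z}
      \<and> N u2 \<inter> W = {v, z} \<and> N z \<inter> W = {u1, u2}" if v: "v \<in> W" "deg_in W v = 2" for v
  proof -
    obtain u1 u2 where u: "N v \<inter> W = {u1, u2}" "u1 \<noteq> u2" using v by (auto simp: card_2_iff)
    have uW: "u1 \<in> W" "u2 \<in> W" "v \<in> N u1" "v \<in> N u2" "u1 \<in> N v" "u2 \<in> N v" using nbW[OF u(1)] by auto
    obtain z1 where z1: "z1 \<noteq> v" "N u1 \<inter> W = {v, z1}" "z1 \<in> W" "deg_in W z1 = 2"
      using other_nb[OF v uW(5,1)] by blast
    obtain z2 where z2: "z2 \<noteq> v" "N u2 \<inter> W = {v, z2}" "z2 \<in> W" "deg_in W z2 = 2"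
      using other_nb[OF v uW(6,2)] by blast
    have zN: "z1 \<in> N u1" "u1 \<in> N z1" "z2 \<in> N u2" "u2 \<in> N z2" using nbW[OF z1(2)] nbW[OF z2(2)] by auto
    have t: "u2 \<notin> N u1" "u1 \<notin> N u2" using tri[OF v(1) u] N_sym[of u1 u2] by auto
    have d1: "deg_in W u1 = 2" "deg_in W u2 = 2" using deg2[OF v, of u1] deg2[OF v, of u2] uW by auto
    have "z1 = z2"
    proof (rule ccontr)
      assume ne: "z1 \<noteq> z2"
      obtain y where y: "y \<noteq> u1" "N z1 \<inter> W = {u1, y}" "y \<in> W" "deg_in W y = 2"
        using other_nb[OF uW(1) d1(1) zN(1) z1(3)] by blast
      have yN: "y \<in> N z1" "z1 \<in> N y" using nbW[OF y(2)] by auto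
      have zv: "z1 \<noteq> u1" "z1 \<noteq> u2" "z2 \<noteq> u1" "z2 \<noteq> u2" using zN t by auto
      have yv: "y \<noteq> v" using yN(2) z1(3) zv u(1) by auto
      have yu: "y \<noteq> u2" using yN(2) z1 z2(2) ne by auto
      have yz: "y \<noteq> z1" using yN by auto
      have vu: "v \<noteq> u1" "v \<noteq> u2" using uW by auto
      show False
      proof (cases "y = z2")
        case True
        have Nz2: "N z2 \<inter> W = {u2, z1}"
          using z2(4) zN yN True uW(2) z1(3) zv by (intro pairI) auto
        show False
        proof (rule step[of "{v, z1}" "{v, u1, u2, z1, z2}" "{}"])
          have 1: "{v, u1, u2, z1, z2} \<subseteq> balls {v, z1}"
            using uW zN yN True by (auto simp: balls_def ball_def)
          then show "{v, u1, u2, z1, z2} \<subseteq> W \<inter> balls {v, z1}" using v uW z1 z2 by auto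
          have "e \<le> val {v, z1} v" "e \<le> val {v, z1} u1" "e \<le> val {v, z1} u2"
            "e \<le> val {v, z1} z1" "e \<le> val {v, z1} z2"
            using 1 True val0[OF v(1) u(1)] val0[OF uW(1) z1(2)] val0[OF uW(2) z2(2)]
              val0[OF z1(3) y(2)] val0[OF z2(3) Nz2] by simp_all
          then show "M * card {v, z1} \<le> (\<Sum>u\<in>{v, u1, u2, z1, z2}. val {v, z1} u) + (\<Sum>x\<in>{}. b 1 - \<delta>)"
            using M u ne zv vu z1 z2 by simp
        qed (use v(1) z1(3) W in auto)
      next
        case False
        obtain y' where y': "y' \<noteq> z1" "N y \<inter> W = {z1, y'}" "y' \<in> W"
          using other_nb[OF z1(3,4) yN(1) y(3)] by blast
        have yN': "y' \<in> N y" "y \<in> N y'" using nbW[OF y'(2)] by auto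
        have ne': "y' \<noteq> v" "y' \<noteq> u1" "y' \<noteq> u2" "y' \<noteq> y"
          using yN' y(1,3) yu yv yz z1(2) z2(2) u(1) False by auto
        show False
        proof (rule step[of "{v, y}" "{v, u1, u2, z1, y, y'}" "{}"])
          have 1: "{v, u1, u2, z1, y, y'} \<subseteq> balls {v, y}"
            using uW zN yN yN' by (auto simp: balls_def ball_def)
          then show "{v, u1, u2, z1, y, y'} \<subseteq> W \<inter> balls {v, y}" using v uW z1 y y' by auto
          have "e \<le> val {v, y} v" "e \<le> val {v, y} u1" "e \<le> val {v, y} z1" "e \<le> val {v, y} y"
            using 1 val0[OF v(1) u(1)] val0[OF uW(1) z1(2)] val0[OF z1(3) y(2)] val0[OF y(3) y'(2)]
            by simp_all
          moreover have "e - b 1 \<le> val {v, y} u2" "e - b 1 \<le> val {v, y} y'"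
            using val1[of u2 v "{v, y}"] val1[of y' y "{v, y}"] uW v(1) y(3) y'(3) yN' by (simp_all add: self)
          ultimately show "M * card {v, y} \<le> (\<Sum>u\<in>{v, u1, u2, z1, y, y'}. val {v, y} u) + (\<Sum>x\<in>{}. b 1 - \<delta>)"
            using M u(2) zv vu z1(1) y(1) yu yv yz y'(1) ne' by simp
        qed (use v(1) y(3) W in auto)
      qed
    qed
    then have "N z1 \<inter> W = {u1, u2}"
      using z1(4) zN uW u(2) by (intro pairI) auto
    then show ?thesis using u z1 z2 \<open>z1 = z2\<close> by blast
  qed

  obtain u1 u2 z where C4: "u1 \<noteq> u2" "z \<noteq> v0" "N v0 \<inter> W = {u1, u2}" "N u1 \<inter> W = {v0, z}"
      "N u2 \<inter> W = {v0, z}" "N z \<inter> W = {u1, u2}" using c4[OF v0] by blast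
  let ?C = "{v0, u1, u2, z}"
  have CN: "u1 \<in> N v0" "u2 \<in> N v0" "z \<in> N u1" "z \<in> N u2" "u1 \<in> N z" "u2 \<in> N z" "u1 \<in> W" "u2 \<in> W" "z \<in> W"
    "v0 \<in> N u1" "v0 \<in> N u2"
    using nbW[OF C4(3)] nbW[OF C4(4)] nbW[OF C4(5)] nbW[OF C4(6)] by auto
  have Cdist: "v0 \<noteq> u1" "v0 \<noteq> u2" "u1 \<noteq> z" "u2 \<noteq> z" using CN by auto
  have Ccard: "card ?C = 4" using Cdist C4 by simp
  \<comment> \<open>\<open>v0\<close> has two white neighbours but at least three
    neighbours.\<close>
  have "\<not> N v0 \<subseteq> W"
  proof
    assume "N v0 \<subseteq> W"
    then have "N v0 \<inter> W = N v0" by auto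
    then show False using v0 d3 card_N WV by simp
  qed
  then obtain x where x: "x \<in> N v0" "x \<notin> W" by auto
  \<comment> \<open>Taking \<open>x\<close> turns the 4-cycle into a path, which its midpoint \<open>z\<close> dominates.\<close>
  have xV: "x \<in> V - W" and xv: "v0 \<in> N x" using x in_V N_sym by auto
  show False
  proof (cases "N x \<inter> W \<subseteq> ?C")
    case True
    \<comment> \<open>If all white neighbours of \<open>x\<close> lie on the cycle, there are at
      most three, so a cycle vertex is missed. The vertex \<open>c\<close> opposite to it dominates
      all of them; the gain is \<open>e + 2 * (e - b 1) + (b 1 - \<delta>)\<close>.\<close>
    have cov: False if c: "c \<in> W" "N c \<inter> W = {p, r}" "p \<noteq> r" and sub: "N x \<inter> W \<subseteq> {c, p, r}" for c p r
    proof (rule step[of "{c}" "{c, p, r}" "{x}"])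
      have cN: "p \<in> N c" "r \<in> N c" "p \<in> W" "r \<in> W" "c \<in> N p" "c \<in> N r" using nbW[OF c(2)] by auto
      show 1: "{c, p, r} \<subseteq> W \<inter> balls {c}" using c cN by (auto simp: balls_def ball_def)
      show "\<And>y. y \<in> {x} \<Longrightarrow> N y \<inter> W \<subseteq> balls {c}" using sub 1 by auto
      have "e \<le> val {c} c" using 1 by (intro val0[OF c(1,2)]) auto
      moreover have "e - b 1 \<le> val {c} p" "e - b 1 \<le> val {c} r"
        using val1[of p c "{c}"] val1[of r c "{c}"] c(1) cN by (simp_all add: self)
      moreover have "c \<noteq> p" "c \<noteq> r" using cN by auto
      ultimately show "M * card {c} \<le> (\<Sum>u\<in>{c, p, r}. val {c} u) + (\<Sum>x\<in>{x}. b 1 - \<delta>)"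
        using M(1) c by simp
    qed (use c(1) W xV xv v0 in auto)
    have "\<not> ?C \<subseteq> N x \<inter> W"
      using blue[OF xV] Ccard card_mono[of "N x \<inter> W" ?C] by auto
    then consider "v0 \<notin> N x" | "u1 \<notin> N x" | "u2 \<notin> N x" | "z \<notin> N x" using v0 CN by auto
    then show False
    proof cases
      case 1 then show ?thesis using xv by simp
    next
      case 2 then show ?thesis using cov[of u2 v0 z] True C4 CN by auto
    next
      case 3 then show ?thesis using cov[of u1 v0 z] True C4 CN by auto
    next
      case 4 then show ?thesis using cov[of v0 u1 u2] True C4 v0 by auto
    qed
  next
    case False
    then obtain y where y: "y \<in> N x" "y \<in> W" "y \<notin> ?C" by auto
    have xz: "x \<noteq> z" using x CN by auto
    have Cval: "e \<le> val T v0" "e \<le> val T u1" "e \<le> val T u2" "e \<le> val T z" if "{x, z} \<subseteq> T" for T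
    proof -
      have "?C \<subseteq> balls T" using that xv CN by (auto simp: balls_def ball_def)
      then show "e \<le> val T v0" "e \<le> val T u1" "e \<le> val T u2" "e \<le> val T z"
        using val0[OF v0(1) C4(3)] val0[OF CN(7) C4(4)] val0[OF CN(8) C4(5)] val0[OF CN(9) C4(6)]
        by simp_all
    qed
    have Cin: "?C \<subseteq> W \<inter> balls T" if "{x, z} \<subseteq> T" for T
      using that xv CN v0 by (auto simp: balls_def ball_def)
    \<comment> \<open>Two white neighbours of \<open>x\<close> off the cycle suffice even if each
      keeps two white neighbours, hence the term \<open>2 * b 2\<close>. Otherwise the white degree
      of \<open>y\<close> decides.\<close>
    show False
    proof (cases "\<exists>y2. y2 \<in> N x \<inter> W \<and> y2 \<notin> ?C \<and> y2 \<noteq> y")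
      case True
      then obtain y2 where y2: "y2 \<in> N x" "y2 \<in> W" "y2 \<notin> ?C" "y2 \<noteq> y" by auto
      show False
      proof (rule step[of "{x, z}" "{v0, u1, u2, z, y, y2}" "{x}"])
        show "{v0, u1, u2, z, y, y2} \<subseteq> W \<inter> balls {x, z}"
          using Cin[of "{x, z}"] y y2 nb[of x "{x, z}"] by simp
        show "M * card {x, z} \<le> (\<Sum>u\<in>{v0, u1, u2, z, y, y2}. val {x, z} u) + (\<Sum>x\<in>{x}. b 1 - \<delta>)"
          using M(4) Cval[of "{x, z}"] val2[OF y(2), of "{x, z}"] val2[OF y2(2), of "{x, z}"]
            y(3) y2(3,4) Cdist C4(1,2) xz by (simp add: eq_commute)
      qed (use xV CN(9) W xv v0 in \<open>auto simp: balls_def ball_def\<close>)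
    next
      case False
      show False
      proof (cases "deg_in W y = 2")
        case False
        then have "deg_in W y \<le> 1" using white[OF y(2)] by simp
        \<comment> \<open>Together with the gain from \<open>x\<close> the corrections cancel:
          \<open>4 * e + (e - b 1 + \<delta>) + (b 1 - \<delta>) = 5 * e\<close>.\<close>
        then have vy: "e - b 1 + \<delta> \<le> val {x, z} y" using y by (intro val_low)
        show False
        proof (rule step[of "{x, z}" "{v0, u1, u2, z, y}" "{x}"])
          show "{v0, u1, u2, z, y} \<subseteq> W \<inter> balls {x, z}"
            using Cin[of "{x, z}"] y nb[of x "{x, z}"] by simp
          show "M * card {x, z} \<le> (\<Sum>u\<in>{v0, u1, u2, z, y}. val {x, z} u) + (\<Sum>x\<in>{x}. b 1 - \<delta>)"
            using M(2) Cval[of "{x, z}"] vy y(3) Cdist C4(1,2) xz by (simp add: eq_commute)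
        qed (use xV CN(9) W xv v0 in \<open>auto simp: balls_def ball_def\<close>)
      next
        case True
        \<comment> \<open>\<open>y\<close> lies on a second 4-cycle, disjoint from the first because
          no white edge leaves that one. Now \<open>x\<close> takes one vertex from each cycle, and
          \<open>z\<close>, \<open>z'\<close> take the remaining paths.\<close>
        obtain p r z' where D4: "p \<noteq> r" "z' \<noteq> y" "N y \<inter> W = {p, r}" "N p \<inter> W = {y, z'}"
          "N r \<inter> W = {y, z'}" "N z' \<inter> W = {p, r}" using c4[OF y(2) True] by blast
        have DN: "p \<in> N y" "r \<in> N y" "z' \<in> N p" "z' \<in> N r" "p \<in> N z'" "r \<in> N z'" "p \<in> W" "r \<in> W"
          "z' \<in> W" "y \<in> N p" "y \<in> N r"
          using nbW[OF D4(3)] nbW[OF D4(4)] nbW[OF D4(5)] nbW[OF D4(6)] by auto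
        have Ddist: "y \<noteq> p" "y \<noteq> r" "p \<noteq> z'" "r \<noteq> z'" using DN by auto
        have closed: "w' \<in> ?C" if "w \<in> ?C" "w' \<in> N w" "w' \<in> W" for w w'
          using that C4 by auto
        have pC: "p \<notin> ?C" "r \<notin> ?C" using closed[of p y] closed[of r y] DN y by blast+
        have zC: "z' \<notin> ?C" using closed[of z' p] DN pC by blast
        let ?T = "{x, z, z'}"
        have zz: "x \<noteq> z'" "z \<noteq> z'" using DN x zC by auto
        have DT: "{y, p, r, z'} \<subseteq> balls ?T" using y DN by (auto simp: balls_def ball_def)
        have Dval: "e \<le> val ?T y" "e \<le> val ?T p" "e \<le> val ?T r" "e \<le> val ?T z'"
          using DT val0[OF y(2) D4(3)] val0[OF DN(7) D4(4)] val0[OF DN(8) D4(5)] val0[OF DN(9) D4(6)]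
          by simp_all
        show False
        proof (rule step[of ?T "{v0, u1, u2, z, y, p, r, z'}" "{x}"])
          show "{v0, u1, u2, z, y, p, r, z'} \<subseteq> W \<inter> balls ?T"
            using Cin[of ?T] DT y DN by auto
          show "M * card ?T \<le> (\<Sum>u\<in>{v0, u1, u2, z, y, p, r, z'}. val ?T u) + (\<Sum>x\<in>{x}. b 1 - \<delta>)"
            using M(5) Cval[of ?T] Dval y(3) pC zC Cdist C4(1,2) Ddist D4(1,2) xz zz by (simp add: eq_commute)
        qed (use xV CN(9) DN(9) W xv v0 in \<open>auto simp: balls_def ball_def\<close>)
      qed
    qed
  qed
qed

section \<open>From improving sets to a bound on the domination number\<close>

text \<open>By induction on the size of \<open>W\<close>, improving sets are collected until no
  white vertex is left; each dominator is paid for by a weight loss of \<open>M\<close>, and the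
  initial weight \<open>pot V\<close> is \<open>a * card V\<close>. The condition on blue vertices
  in \<open>step\<close> holds vacuously for \<open>W = V\<close> and is preserved.\<close>

lemma domination_bound:
  assumes M: "0 \<le> M"
    and step: "\<And>W. W \<subseteq> V \<Longrightarrow> W \<noteq> {} \<Longrightarrow> (\<And>x. x \<in> V - W \<Longrightarrow> deg_in W x < d) \<Longrightarrow> improvable W"
  shows "M * domination_number V E \<le> a * card V"
proof -
  have "\<exists>T\<subseteq>V. W \<subseteq> balls T \<and> M * card T \<le> pot W"
    if "W \<subseteq> V" "\<And>x. x \<in> V - W \<Longrightarrow> deg_in W x < d" for W
    using that
  proof (induction "card W" arbitrary: W rule: less_induct)
    case less
    note blue = less.prems(2)
    show ?case
    proof (cases "W = {}")
      case True
      then show ?thesis by (intro exI[of _ "{}"]) (simp add: pot_def)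
    next
      case False
      have "improvable W" by (rule step[OF less.prems(1) False blue])
      then obtain T where T: "T \<subseteq> V" "W \<inter> balls T \<noteq> {}" "pot (W - balls T) + M * card T \<le> pot W"
        unfolding improvable_def by blast
      let ?W = "W - balls T"
      have "finite W" using less.prems finite_V finite_subset by blast
      then have "card ?W < card W" using T by (intro psubset_card_mono) auto
      \<comment> \<open>A newly dominated \<open>x\<close> is either chosen itself and keeps no
        white neighbour, or has a chosen neighbour, which is no longer white.\<close>
      moreover have "deg_in ?W x < d" if x: "x \<in> V - ?W" for x
      proof (cases "x \<in> W")
        case False
        have "deg_in ?W x \<le> deg_in W x" by (intro card_mono) auto
        then show ?thesis using blue[of x] False x by simp
      next
        case True
        then obtain t where t: "t \<in> T" "x \<in> ball t" using x by (auto simp: balls_def)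
        have "N x \<inter> ?W \<subset> N x"
        proof (cases "x = t")
          case True
          then have "N x \<inter> ?W = {}" using t by (auto simp: balls_def ball_def)
          moreover have "N x \<noteq> {}" using card_N[of x] x d_pos by fastforce
          ultimately show ?thesis by auto
        next
          case False
          then have "t \<in> N x" "t \<in> balls T" using t N_sym by (auto simp: balls_def ball_def)
          then show ?thesis by auto
        qed
        then show ?thesis using psubset_card_mono[of "N x"] card_N x by simp
      qed
      moreover have "?W \<subseteq> V" using less.prems(1) by auto
      ultimately have "\<exists>T'\<subseteq>V. ?W \<subseteq> balls T' \<and> M * card T' \<le> pot ?W"
        by (intro less.hyps)
      then obtain T' where T': "T' \<subseteq> V" "?W \<subseteq> balls T'" "M * card T' \<le> pot ?W" by blast
      have "W \<subseteq> balls (T \<union> T')" using T'(2) by (auto simp: balls_def)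
      moreover have "M * card (T \<union> T') \<le> M * (real (card T) + real (card T'))"
        using M card_Un_le[of T T'] by (intro mult_left_mono) auto
      then have "M * card (T \<union> T') \<le> pot W" using T(3) T'(3) by (simp add: algebra_simps)
      ultimately show ?thesis using T(1) T'(1) by (intro exI[of _ "T \<union> T'"]) auto
    qed
  qed
  from this[of V] obtain T where T: "T \<subseteq> V" "V \<subseteq> balls T" "M * card T \<le> pot V" by auto
  have "M * domination_number V E \<le> M * card T"
    using M T domination_number_le[of T] by (intro mult_left_mono) (auto simp: dominating_iff)
  also have "\<dots> \<le> a * card V" using T(3) by (simp add: pot_def mult.commute)
  finally show ?thesis .
qed

text \<open>The increments of \<open>b\<close> telescope, and only those up to \<open>q\<close>
  matter, as no blue vertex has more white neighbours.\<close>

lemma slopeI: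
  assumes "0 \<le> \<delta>" and blue: "\<And>x. x \<in> V - W \<Longrightarrow> deg_in W x \<le> q"
    and inc: "\<And>i. i < q \<Longrightarrow> b i + \<delta> \<le> b (Suc i)"
  shows "slope W \<delta>"
proof -
  have "b j + \<delta> * (real i - real j) \<le> b i" if "j \<le> i" "i \<le> q" for i j
    using that
  proof (induction i rule: dec_induct)
    case (step i)
    then show ?case using inc[of i] by (simp add: algebra_simps)
  qed simp
  then show ?thesis unfolding slope_def using assms(1) blue by blast
qed

text \<open>This and the next two lemmas are contrapositives of step lemmas: if nothing improves
  \<open>W\<close>, the extreme degree cannot occur, so the degree bound drops by one.\<close>

lemma white_bound:
  assumes no: "\<not> improvable W" and W: "W \<subseteq> V" and sl: "slope W \<delta>"
    and max: "\<And>u. u \<in> W \<Longrightarrow> deg_in W u \<le> p"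
    and M: "M \<le> (real p + 1) * (a + \<delta> * (real d - real p)) - real p * b (p - 1)"
    and u: "u \<in> W"
  shows "deg_in W u \<le> p - 1"
  using white_step[OF W sl u _ max M] no max[OF u] by linarith

lemma cycle_bound:
  fixes \<delta> :: real
  defines "e \<equiv> a + \<delta> * (real d - 2)"
  assumes no: "\<not> improvable W" and W: "W \<subseteq> V" and sl: "slope W \<delta>"
    and white: "\<And>u. u \<in> W \<Longrightarrow> deg_in W u \<le> 2" and blue: "\<And>x. x \<in> V - W \<Longrightarrow> deg_in W x \<le> 3"
    and u: "u \<in> W" and d3: "3 \<le> d"
    and M: "M \<le> 3 * e - b 1 - \<delta>" "2 * M \<le> 5 * e" "2 * M \<le> 6 * e - 2 * b 1"
      "2 * M \<le> 6 * e - 2 * b 2 + b 1 - \<delta>" "3 * M \<le> 8 * e + b 1 - \<delta>"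
  shows "deg_in W u \<le> 1"
proof -
  have "deg_in W u \<noteq> 2"
    using cycle_step[OF W sl d3 white blue u _ M[unfolded e_def]] no by blast
  then show ?thesis using white[OF u] by simp
qed

lemma blue_bound:
  assumes no: "\<not> improvable W" and W: "W \<subseteq> V" and sl: "slope W \<delta>"
    and max: "\<And>u. u \<in> W \<Longrightarrow> deg_in W u \<le> p"
    and blue: "\<And>x. x \<in> V - W \<Longrightarrow> deg_in W x \<le> q"
    and M: "M \<le> real q * (a - b p + \<delta> * (real d - real p)) + b q - \<delta> * real q" and q: "0 < q"
    and x: "x \<in> V - W"
  shows "deg_in W x \<le> q - 1"
  using blue_step[OF W sl x _ q max M] no blue[OF x] by linarith

end

section \<open>Weights for degrees 3, 4 and 5\<close>

context regular_graph
begin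

text \<open>The weights in the next three lemmas solve the linear programs given by the numerical
  hypotheses of the step lemmas.\<close>

lemma domination_cubic:
  assumes "d = 3"
  shows "12 * domination_number V E \<le> 5 * card V"
proof -
  define b :: "nat \<Rightarrow> real"
    where "b i = (if i = 0 then 0 else if i = 1 then 7 else if i = 2 then 8 else 9)" for i
  \<comment> \<open>The ratio \<open>15 / 36\<close> is \<open>5 / 12\<close>. Tight are
    \<open>M_single\<close>, by \<open>15 + 3 * 7 = 36\<close>, and the bound at white degree 3, by
    \<open>4 * 15 - 3 * 8 = 36\<close>.\<close>
  interpret potential V E d 15 b 36
    by unfold_locales (auto simp: b_def mono_iff_le_Suc)
  have "36 * real (domination_number V E) \<le> 15 * real (card V)"
  proof (rule domination_bound)
    fix W assume W: "W \<subseteq> V" "W \<noteq> {}" and lt: "\<And>x. x \<in> V - W \<Longrightarrow> deg_in W x < d"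
    show "improvable W"
    proof (rule ccontr)
      assume no: "\<not> improvable W"
      have blue2: "deg_in W x \<le> 2" if "x \<in> V - W" for x using lt[OF that] assms by simp
      have white3: "deg_in W u \<le> 3" if "u \<in> W" for u using deg_in_le_d[of u W] that W assms by auto
      have sl: "slope W 1" by (rule slopeI[OF _ blue2]) (auto simp: b_def)
      have white2: "deg_in W u \<le> 2" if "u \<in> W" for u
        using white_bound[OF no W(1) sl white3 _ that] assms by (simp add: b_def)
      have blue3: "deg_in W x \<le> 3" if "x \<in> V - W" for x using blue2[OF that] by simp
      \<comment> \<open>At white degree 2 the bound of \<open>white_step\<close> would be only
        \<open>3 * 16 - 2 * 7 = 34\<close>, hence the argument on cycles.\<close>
      have white1: "deg_in W u \<le> 1" if "u \<in> W" for u
        by (rule cycle_bound[OF no W(1) sl white2 blue3 that]) (use assms in \<open>auto simp: b_def\<close>)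
      have "improvable W"
        by (rule gain_two_step[OF W white1 blue2]) (use assms in \<open>auto simp: b_def\<close>)
      with no show False by simp
    qed
  qed simp
  then show ?thesis by linarith
qed

lemma domination_quartic:
  assumes "d = 4"
  shows "5 * domination_number V E \<le> 2 * card V"
proof -
  define b :: "nat \<Rightarrow> real"
    where "b i = (if i = 0 then 0 else if i = 1 then 15 else if i = 2 then 17 else 19)" for i
  interpret potential V E d 40 b 100
    by unfold_locales (auto simp: b_def mono_iff_le_Suc)
  have "100 * real (domination_number V E) \<le> 40 * real (card V)"
  proof (rule domination_bound)
    fix W assume W: "W \<subseteq> V" "W \<noteq> {}" and lt: "\<And>x. x \<in> V - W \<Longrightarrow> deg_in W x < d"
    show "improvable W"
    proof (rule ccontr)
      assume no: "\<not> improvable W"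
      have blue3: "deg_in W x \<le> 3" if "x \<in> V - W" for x using lt[OF that] assms by simp
      have white4: "deg_in W u \<le> 4" if "u \<in> W" for u using deg_in_le_d[of u W] that W assms by auto
      have sl: "slope W 2" by (rule slopeI[OF _ blue3]) (auto simp: b_def)
      have white3: "deg_in W u \<le> 3" if "u \<in> W" for u
        using white_bound[OF no W(1) sl white4 _ that] assms by (simp add: b_def)
      have white2: "deg_in W u \<le> 2" if "u \<in> W" for u
        using white_bound[OF no W(1) sl white3 _ that] assms by (simp add: b_def)
      \<comment> \<open>Here \<open>3 * (40 + 2 * 2) - 2 * 15 = 102\<close>, so a single vertex also
        handles the cycles.\<close>
      have white1: "deg_in W u \<le> 1" if "u \<in> W" for u
        using white_bound[OF no W(1) sl white2 _ that] assms by (simp add: b_def)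
      have blue2: "deg_in W x \<le> 2" if "x \<in> V - W" for x
        using blue_bound[OF no W(1) sl white1 blue3 _ _ that] assms by (simp add: b_def)
      have "improvable W"
        by (rule gain_two_step[OF W white1 blue2]) (use assms in \<open>auto simp: b_def\<close>)
      with no show False by simp
    qed
  qed simp
  then show ?thesis by linarith
qed

lemma domination_quintic:
  assumes "d = 5"
  shows "3 * domination_number V E \<le> card V"
proof -
  define b :: "nat \<Rightarrow> real"
    where "b i = (if i = 0 then 0 else if i = 1 then 60 else if i = 2 then 71 else if i = 3 then 82 else 90)" for i
  interpret potential V E d 150 b 450
    by unfold_locales (auto simp: b_def mono_iff_le_Suc)
  have "450 * real (domination_number V E) \<le> 150 * real (card V)"
  proof (rule domination_bound)
    fix W assume W: "W \<subseteq> V" "W \<noteq> {}" and lt: "\<And>x. x \<in> V - W \<Longrightarrow> deg_in W x < d"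
    show "improvable W"
    proof (rule ccontr)
      assume no: "\<not> improvable W"
      have blue4: "deg_in W x \<le> 4" if "x \<in> V - W" for x using lt[OF that] assms by simp
      have white5: "deg_in W u \<le> 5" if "u \<in> W" for u using deg_in_le_d[of u W] that W assms by auto
      have sl: "slope W 8" by (rule slopeI[OF _ blue4]) (auto simp: b_def)
      have white4: "deg_in W u \<le> 4" if "u \<in> W" for u
        using white_bound[OF no W(1) sl white5 _ that] assms by (simp add: b_def)
      have white3: "deg_in W u \<le> 3" if "u \<in> W" for u
        using white_bound[OF no W(1) sl white4 _ that] assms by (simp add: b_def)
      have white2: "deg_in W u \<le> 2" if "u \<in> W" for u
        using white_bound[OF no W(1) sl white3 _ that] assms by (simp add: b_def)
      have blue3: "deg_in W x \<le> 3" if "x \<in> V - W" for x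
        using blue_bound[OF no W(1) sl white2 blue4 _ _ that] assms by (simp add: b_def)
      \<comment> \<open>Excluding four white neighbours removes the smallest increment,
        \<open>90 - 82 = 8\<close>. For cycles the slope 8 would be too small: it gives
        \<open>5 * e = 870\<close>, below \<open>2 * M = 900\<close>.\<close>
      have sl': "slope W 11" by (rule slopeI[OF _ blue3]) (auto simp: b_def)
      have white1: "deg_in W u \<le> 1" if "u \<in> W" for u
        by (rule cycle_bound[OF no W(1) sl' white2 blue3 that]) (use assms in \<open>auto simp: b_def\<close>)
      have blue2: "deg_in W x \<le> 2" if "x \<in> V - W" for x
        using blue_bound[OF no W(1) sl' white1 blue3 _ _ that] assms by (simp add: b_def)
      have "improvable W"
        by (rule gain_two_step[OF W white1 blue2]) (use assms in \<open>auto simp: b_def\<close>)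
      with no show False by simp
    qed
  qed simp
  then show ?thesis by linarith
qed

end

section \<open>Covers\<close>

text \<open>Neighbourhoods are mapped bijectively, so \<open>G\<close> is \<open>d\<close>-regular
  as well, and the fibres split \<open>VG\<close> into \<open>card VF\<close> classes of size
  \<open>k\<close>. The counting bound for regular graphs then applies to \<open>G\<close>.\<close>

lemma cover_domination_ge:
  assumes F: "simple_graph VF EF" and G: "simple_graph VG EG"
    and cover: "k_fold_cover VG EG VF EF k" and reg: "regular VF EF d" and d: "0 < d"
  shows "k * card VF \<le> Suc d * domination_number VG EG"
proof -
  obtain p where p: "covering_map VG EG VF EF p" and fibre: "\<And>u. u \<in> VF \<Longrightarrow> card {v \<in> VG. p v = u} = k"
    using cover by (auto simp: k_fold_cover_def)
  have onto: "p ` VG = VF"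
    and bij: "\<And>v. v \<in> VG \<Longrightarrow> bij_betw p (nbhd VG EG v) (nbhd VF EF (p v))"
    using p by (auto simp: covering_map_def)
  have "card (nbhd VG EG v) = d" if "v \<in> VG" for v
    using bij_betw_same_card[OF bij[OF that]] reg onto that by (auto simp: regular_def)
  then interpret regular_graph VG EG d
    using G d by unfold_locales (auto simp: regular_def)
  have finF: "finite VF" using F by (simp add: simple_graph_def)
  have "VG = (\<Union>u\<in>VF. {v \<in> VG. p v = u})" using onto by auto
  moreover have "card (\<Union>u\<in>VF. {v \<in> VG. p v = u}) = (\<Sum>u\<in>VF. card {v \<in> VG. p v = u})"
    using finF finite_V by (intro card_UN_disjoint) auto
  ultimately have "card VG = k * card VF" using fibre by simp
  then show ?thesis using card_le_domination_number by simp
qed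

theorem theorem2p6:
  fixes VF :: "'b set" and EF :: "'b \<Rightarrow> 'b \<Rightarrow> bool"
    and VG :: "'a set" and EG :: "'a \<Rightarrow> 'a \<Rightarrow> bool" and k :: nat
  assumes "simple_graph VF EF" and "simple_graph VG EG"
    and "k_fold_cover VG EG VF EF k"
  shows "(regular VF EF 3 \<longrightarrow>
            real (domination_number VG EG) \<ge> 3 / 5 * real k * real (domination_number VF EF))
       \<and> ((regular VF EF 4 \<or> regular VF EF 5) \<longrightarrow>
            real (domination_number VG EG) \<ge> 1 / 2 * real k * real (domination_number VF EF))"
proof -
  let ?F = "real (domination_number VF EF)" and ?G = "real (domination_number VG EG)"
  \<comment> \<open>With \<open>c = 12 / 5\<close>, \<open>5 / 2\<close>, \<open>3\<close> for
    \<open>d = 3\<close>, \<open>4\<close>, \<open>5\<close>, the quotient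
    \<open>c / (d + 1)\<close> is \<open>3 / 5\<close>, \<open>1 / 2\<close>,
    \<open>1 / 2\<close>.\<close>
  have ratio: "real k * (c * ?F) \<le> real (Suc d) * ?G"
    if "regular VF EF d" "0 < d" "c * ?F \<le> real (card VF)" for d c
  proof -
    have "real k * (c * ?F) \<le> real k * real (card VF)" using that by (intro mult_left_mono) auto
    also have "\<dots> = real (k * card VF)" by simp
    also have "\<dots> \<le> real (Suc d * domination_number VG EG)"
      using cover_domination_ge[OF assms that(1,2)] by (intro of_nat_mono)
    finally show ?thesis by (simp only: of_nat_mult)
  qed
  have loc: "regular_graph VF EF d" if "regular VF EF d" "0 < d" for d
    using assms that by unfold_locales auto
  have "3 / 5 * real k * ?F \<le> ?G" if "regular VF EF 3"
  proof -
    have "real (12 * domination_number VF EF) \<le> real (5 * card VF)"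
      using regular_graph.domination_cubic[OF loc] that by (intro of_nat_mono) auto
    then show ?thesis using ratio[of 3 "12 / 5"] that by simp
  qed
  moreover have "1 / 2 * real k * ?F \<le> ?G" if "regular VF EF 4"
  proof -
    have "real (5 * domination_number VF EF) \<le> real (2 * card VF)"
      using regular_graph.domination_quartic[OF loc] that by (intro of_nat_mono) auto
    then show ?thesis using ratio[of 4 "5 / 2"] that by simp
  qed
  moreover have "1 / 2 * real k * ?F \<le> ?G" if "regular VF EF 5"
  proof -
    have "real (3 * domination_number VF EF) \<le> real (card VF)"
      using regular_graph.domination_quintic[OF loc] that by (intro of_nat_mono) auto
    then show ?thesis using ratio[of 5 3] that by simp
  qed
  ultimately show ?thesis by blast
qed

end
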